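(* Let $\mathcal{L}\in\{\mathrm{PL},\mathrm{PL}(\underline{\vee}),\mathrm{PD}\}$. The calculus $\mathbf{T}_{\mathcal{L}}$ is sound: if there is a closed tableau for an $\mathcal{L}$-formula $\varphi$ in $\mathbf{T}_{\mathcal{L}}$, then $\varphi$ is valid.
   Context: Syntax (negation normal form): $\mathrm{PL}$: $\varphi::=p\mid\neg p\mid(\varphi\wedge\varphi)\mid(\varphi\vee\varphi)$; $\mathrm{PL}(\underline{\vee})$ adds $(\varphi\,\underline{\vee}\,\varphi)$; $\mathrm{PD}$ adds atoms ${=}(p_1,\dots,p_n,q)$. $p^\top:=p$, $p^\bot:=\neg p$. Team semantics: a team $X$ is a set of assignments $s:D\to\{0,1\}$ ($D$ a finite set of proposition symbols containing those of the formula). $X\models p$ iff $s(p)=1$ for all $s\in X$; $X\models\neg p$ iff $s(p)=0$ for all $s\in X$; $\wedge$ conjunctively; $X\models\varphi\vee\psi$ iff $X=Y\cup Z$ with $Y\models\varphi$, $Z\models\psi$; $X\models\varphi\,\underline{\vee}\,\psi$ iff $X\models\varphi$ or $X\models\psi$; $X\models{=}(p_1,\dots,p_n,q)$ iff any $s,t\in X$ agreeing on all $p_i$ agree on $q$. Valid: true in every team. $\mathrm{vrank}(\varphi)$: number of $\underline{\vee}$ in $\varphi$, where each ${=}(p_1,\dots,p_n,q)$ is counted via its replacement $\bigvee_{\vec a\in\{\bot,\top\}^n}\bigwedge\{p_1^{a_1},\dots,p_n^{a_n},(q\,\underline{\vee}\,\neg q)\}$. Labeled tableaux: labels are finite subsets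 of $\mathbb{N}$; labeled formulas $\alpha:\varphi$. A tableau is a finitely branching tree of labeled formulas built from the root by rule applications; each rule extends a branch containing its premise by alternatives (separated by $\mid$), each alternative adding all listed labeled formulas; a labeled formula is never added to a branch already containing it. Rules: (Prop) from $\{i_1,\dots,i_k\}:p$: $\{i_1\}:p\mid\dots\mid\{i_k\}:p$; ($\neg$Prop) likewise for $\neg p$; ($\wedge$) from $\alpha:(\varphi\wedge\psi)$: $\alpha:\varphi\mid\alpha:\psi$; ($\vee$) from $\alpha:(\varphi\vee\psi)$ and any $\beta\subseteq\alpha$: $\beta:\varphi\mid\alpha\setminus\beta:\psi$; ($\underline{\vee}$) from $\alpha:(\varphi\,\underline{\vee}\,\psi)$: add $\alpha:\varphi$ and $\alpha:\psi$; (Split) from $\alpha:{=}(\vec p,q)$: $\alpha_1:{=}(\vec p,q)\mid\dots\mid\alpha_k:{=}(\vec p,q)$ with $\alpha_1,\dots,\alpha_k$ all 2-element subsets of $\alpha$; (PL dep) from $\{i_1,i_2\}:{=}(p_1,\dots,p_n,q)$: one alternative per $g:\{1,\dots,n\}\to\{\top,\bot\}$ adding $\{i_1\}:p_m^{g(m)},\{i_2\}:p_m^{g(m)}$ ($m\le n$), $\{i_1,i_2\}:q$, $\{i_1,i_2\}:\neg q$. $\mathbf{T}_{\mathrm{PL}}$ = (Prop), ($\neg$Prop), ($\wedge$), ($\vee$); $\mathbf{T}_{\mathrm{PL}(\underline{\vee})}$ adds ($\underline{\vee}$); $\mathbf{T}_{\mathrm{PD}}$ adds (Split), (PL dep) to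 $\mathbf{T}_{\mathrm{PL}}$. A tableau for $\varphi$ in $\mathbf{T}_{\mathcal{L}}$ has root $\{1,\dots,2^{\mathrm{vrank}(\varphi)}\}:\varphi$ and uses rules of $\mathbf{T}_{\mathcal{L}}$. A branch is closed if it contains (1) both $\alpha:p$ and $\alpha:\neg p$, or (2) $\emptyset:\psi$ for some $\psi$, or (3) $\{i\}:{=}(p_1,\dots,p_n,q)$ for some $i$; a tableau is closed if all its branches are closed.
   Formalization: Closure condition (1) is required only for singleton labels, {i}:p and {i}:¬p; for arbitrary α the claim is false, since p ⊻ ¬p with root {1,2} would have a closed tableau but is not valid. *)

theory Defs
  imports Main
begin

section \<open>Syntax\<close>

text \<open>One datatype hosts all three logics; \<open>formula_of\<close> carves out the fragments.\<close>

datatype 'p fm =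
    Pos 'p
  | Neg 'p
  | And "'p fm" "'p fm"
  | Or "'p fm" "'p fm"
  | IOr "'p fm" "'p fm"
  | Dep "'p list" 'p

datatype language = PL | PL_IOr | PD

fun formula_of :: "language \<Rightarrow> 'p fm \<Rightarrow> bool" where
  "formula_of L (Pos p) \<longleftrightarrow> True"
| "formula_of L (Neg p) \<longleftrightarrow> True"
| "formula_of L (And \<phi> \<psi>) \<longleftrightarrow> formula_of L \<phi> \<and> formula_of L \<psi>"
| "formula_of L (Or \<phi> \<psi>) \<longleftrightarrow> formula_of L \<phi> \<and> formula_of L \<psi>"
| "formula_of L (IOr \<phi> \<psi>) \<longleftrightarrow> L = PL_IOr \<and> formula_of L \<phi> \<and> formula_of L \<psi>"
| "formula_of L (Dep ps q) \<longleftrightarrow> L = PD"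

fun props :: "'p fm \<Rightarrow> 'p set" where
  "props (Pos p) = {p}"
| "props (Neg p) = {p}"
| "props (And \<phi> \<psi>) = props \<phi> \<union> props \<psi>"
| "props (Or \<phi> \<psi>) = props \<phi> \<union> props \<psi>"
| "props (IOr \<phi> \<psi>) = props \<phi> \<union> props \<psi>"
| "props (Dep ps q) = insert q (set ps)"

fun lit :: "'p \<Rightarrow> bool \<Rightarrow> 'p fm" where
  "lit p True = Pos p"
| "lit p False = Neg p"


section \<open>Team semantics\<close>

text \<open>An assignment \<open>D \<rightarrow> {0,1}\<close> is a partial map with domain \<open>D\<close>.\<close>

type_synonym 'p team = "('p \<rightharpoonup> bool) set"

definition team_on :: "'p set \<Rightarrow> 'p team \<Rightarrow> bool" where
  "team_on D X \<longleftrightarrow> (\<forall>s\<in>X. dom s = D)"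

fun sat :: "'p team \<Rightarrow> 'p fm \<Rightarrow> bool" where
  "sat X (Pos p) \<longleftrightarrow> (\<forall>s\<in>X. s p = Some True)"
| "sat X (Neg p) \<longleftrightarrow> (\<forall>s\<in>X. s p = Some False)"
| "sat X (And \<phi> \<psi>) \<longleftrightarrow> sat X \<phi> \<and> sat X \<psi>"
| "sat X (Or \<phi> \<psi>) \<longleftrightarrow> (\<exists>Y Z. X = Y \<union> Z \<and> sat Y \<phi> \<and> sat Z \<psi>)"
| "sat X (IOr \<phi> \<psi>) \<longleftrightarrow> sat X \<phi> \<or> sat X \<psi>"
| "sat X (Dep ps q) \<longleftrightarrow> (\<forall>s\<in>X. \<forall>t\<in>X. (\<forall>p\<in>set ps. s p = t p) \<longrightarrow> s q = t q)"

definition valid :: "'p fm \<Rightarrow> bool" where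
  "valid \<phi> \<longleftrightarrow> (\<forall>D X. finite D \<and> props \<phi> \<subseteq> D \<and> team_on D X \<longrightarrow> sat X \<phi>)"


section \<open>The rank\<close>

text \<open>Iterated binary connective; only used on nonempty lists.\<close>

fun iterate :: "('p fm \<Rightarrow> 'p fm \<Rightarrow> 'p fm) \<Rightarrow> 'p fm list \<Rightarrow> 'p fm" where
  "iterate c [\<phi>] = \<phi>"
| "iterate c (\<phi> # \<psi> # \<phi>s) = c \<phi> (iterate c (\<psi> # \<phi>s))"

definition dep_replacement :: "'p list \<Rightarrow> 'p \<Rightarrow> 'p fm" where
  "dep_replacement ps q =
     iterate Or
       (map (\<lambda>a. iterate And (map2 lit ps a @ [IOr (Pos q) (Neg q)]))
            (List.n_lists (length ps) [False, True]))"

fun replace_deps :: "'p fm \<Rightarrow> 'p fm" where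
  "replace_deps (Pos p) = Pos p"
| "replace_deps (Neg p) = Neg p"
| "replace_deps (And \<phi> \<psi>) = And (replace_deps \<phi>) (replace_deps \<psi>)"
| "replace_deps (Or \<phi> \<psi>) = Or (replace_deps \<phi>) (replace_deps \<psi>)"
| "replace_deps (IOr \<phi> \<psi>) = IOr (replace_deps \<phi>) (replace_deps \<psi>)"
| "replace_deps (Dep ps q) = dep_replacement ps q"

fun count_IOr :: "'p fm \<Rightarrow> nat" where
  "count_IOr (Pos p) = 0"
| "count_IOr (Neg p) = 0"
| "count_IOr (And \<phi> \<psi>) = count_IOr \<phi> + count_IOr \<psi>"
| "count_IOr (Or \<phi> \<psi>) = count_IOr \<phi> + count_IOr \<psi>"
| "count_IOr (IOr \<phi> \<psi>) = Suc (count_IOr \<phi> + count_IOr \<psi>)"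
| "count_IOr (Dep ps q) = 0"

definition vrank :: "'p fm \<Rightarrow> nat" where
  "vrank \<phi> = count_IOr (replace_deps \<phi>)"


section \<open>Labeled tableaux\<close>

text \<open>The intended reading of \<open>(\<alpha>, \<phi>)\<close> is that the subteam indexed by \<open>\<alpha>\<close> does not
  satisfy \<open>\<phi>\<close>. Labels occurring in a tableau are subsets of the root label and hence finite.\<close>

type_synonym 'p lform = "nat set \<times> 'p fm"

text \<open>\<open>rule_inst L f As\<close>: some rule of the calculus for \<open>L\<close> applies to the premise \<open>f\<close>, and
  \<open>As\<close> is the set of its alternatives, each given by the set of labeled formulas it adds.\<close>

inductive rule_inst :: "language \<Rightarrow> 'p lform \<Rightarrow> 'p lform set set \<Rightarrow> bool" for L where
  Prop: "rule_inst L (\<alpha>, Pos p) {{({i}, Pos p)} | i. i \<in> \<alpha>}"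
| NegProp: "rule_inst L (\<alpha>, Neg p) {{({i}, Neg p)} | i. i \<in> \<alpha>}"
| And: "rule_inst L (\<alpha>, And \<phi> \<psi>) {{(\<alpha>, \<phi>)}, {(\<alpha>, \<psi>)}}"
| Or: "\<beta> \<subseteq> \<alpha> \<Longrightarrow> rule_inst L (\<alpha>, Or \<phi> \<psi>) {{(\<beta>, \<phi>)}, {(\<alpha> - \<beta>, \<psi>)}}"
| IOr: "L = PL_IOr \<Longrightarrow> rule_inst L (\<alpha>, IOr \<phi> \<psi>) {{(\<alpha>, \<phi>), (\<alpha>, \<psi>)}}"
| Split: "L = PD \<Longrightarrow>
    rule_inst L (\<alpha>, Dep ps q) {{(\<gamma>, Dep ps q)} | \<gamma>. \<gamma> \<subseteq> \<alpha> \<and> card \<gamma> = 2}"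
| PLdep: "L = PD \<Longrightarrow> i \<noteq> j \<Longrightarrow>
    rule_inst L ({i, j}, Dep ps q)
      {(\<Union>m<length ps. {({i}, lit (ps ! m) (g ! m)), ({j}, lit (ps ! m) (g ! m))})
         \<union> {({i, j}, Pos q), ({i, j}, Neg q)} | g. length g = length ps}"

text \<open>A node carries the block of labeled formulas contributed by one alternative. Formulas
  already on the branch are left out of the block, so a block can be empty: that alternative
  then continues the branch unchanged. A leaf is a node without children, so a rule instance
  with no alternatives leaves its branch as it is.\<close>

datatype 'p tableau = Node (block: "'p lform set") (children: "'p tableau list")

text \<open>\<open>grown L B T\<close>: the subtree \<open>T\<close>, hanging below nodes whose blocks have union \<open>B\<close>, results
  from rule applications.\<close>

inductive grown :: "language \<Rightarrow> 'p lform set \<Rightarrow> 'p tableau \<Rightarrow> bool" for L where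
  leaf: "grown L B (Node A [])"
| extend: "\<lbrakk>f \<in> B \<union> A; rule_inst L f As; block ` set ts = (\<lambda>C. C - (B \<union> A)) ` As;
     \<forall>t\<in>set ts. grown L (B \<union> A) t\<rbrakk> \<Longrightarrow> grown L B (Node A ts)"

definition tableau_for :: "language \<Rightarrow> 'p fm \<Rightarrow> 'p tableau \<Rightarrow> bool" where
  "tableau_for L \<phi> T \<longleftrightarrow> block T = {({1..2 ^ vrank \<phi>}, \<phi>)} \<and> grown L {} T"

text \<open>A branch is identified with the set of labeled formulas on it.\<close>

fun branches :: "'p tableau \<Rightarrow> 'p lform set set" where
  "branches (Node A ts) =
     (if ts = [] then {A} else (\<lambda>B. A \<union> B) ` (\<Union>t\<in>set ts. branches t))"

text \<open>The clash between \<open>p\<close> and \<open>\<not>p\<close> is required on a singleton label. A team with at least two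
  members may falsify both \<open>p\<close> and \<open>\<not>p\<close>, so closing on larger labels would be unsound:
  it would close tableaux for \<open>IOr (Pos p) (Neg p)\<close> and for \<open>Dep [] q\<close>, neither of which is
  valid.\<close>

definition closed_branch :: "'p lform set \<Rightarrow> bool" where
  "closed_branch B \<longleftrightarrow>
     (\<exists>i p. ({i}, Pos p) \<in> B \<and> ({i}, Neg p) \<in> B) \<or>
     (\<exists>\<psi>. ({}, \<psi>) \<in> B) \<or>
     (\<exists>i ps q. ({i}, Dep ps q) \<in> B)"

definition closed_tableau :: "'p tableau \<Rightarrow> bool" where
  "closed_tableau T \<longleftrightarrow> (\<forall>B\<in>branches T. closed_branch B)"

end

theory Submission
  imports Defs "HOL-Library.FuncSet"
begin

text \<open>A formula of rank \<open>k\<close> is equivalent to an intuitionistic disjunction of at most \<open>2 ^ k\<close>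
  classical (flat) formulas. A team falsifying it contains, for each of these disjuncts, an
  assignment falsifying the disjunct, and these assignments alone form a falsifying subteam of at
  most \<open>2 ^ k\<close> elements. Indexing this subteam by the root label makes the root true under the
  reading of \<open>(\<alpha>, \<psi>)\<close> as failure of \<open>\<psi>\<close> in the subteam indexed by \<open>\<alpha>\<close>. Each rule
  preserves truth in some alternative, and no closed branch is true.\<close>

section \<open>The empty team and the rank of a dependence atom\<close>

lemma sat_empty_team: "sat {} \<phi>"
  by (induction \<phi>) auto

lemma count_IOr_iterate:
  assumes "c = And \<or> c = Or" and "\<phi>s \<noteq> []"
  shows "count_IOr (iterate c \<phi>s) = sum_list (map count_IOr \<phi>s)"
  using assms by (induction c \<phi>s rule: iterate.induct) auto

lemma count_IOr_lit: "count_IOr (lit p b) = 0"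
  by (cases b) auto

lemma count_IOr_map2_lit: "sum_list (map count_IOr (map2 lit ps bs)) = 0"
  by (auto simp: count_IOr_lit)

text \<open>There is one disjunct per Boolean vector, and each contains exactly one
  \<open>IOr\<close>, namely its last conjunct.\<close>

lemma count_IOr_dep_replacement: "count_IOr (dep_replacement ps q) = 2 ^ length ps"
proof -
  define bss where "bss = List.n_lists (length ps) [False, True]"
  define conj where
    "conj = (\<lambda>a. iterate And (map2 lit ps a @ [IOr (Pos q) (Neg q)]))"
  have len: "length bss = 2 ^ length ps"
    by (simp add: bss_def length_n_lists numeral_2_eq_2)
  then have "bss \<noteq> []"
    by auto
  have "count_IOr (conj a) = 1" for a
    unfolding conj_def
    by (subst count_IOr_iterate) (use count_IOr_map2_lit[of ps a] in auto)
  then have one: "count_IOr \<circ> conj = (\<lambda>_. 1)"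
    by auto
  have "count_IOr (dep_replacement ps q) = sum_list (map count_IOr (map conj bss))"
    using \<open>bss \<noteq> []\<close> unfolding dep_replacement_def conj_def bss_def[symmetric]
    by (subst count_IOr_iterate) auto
  also have "\<dots> = 2 ^ length ps"
    using len by (simp only: map_map one) (simp add: sum_list_triv)
  finally show ?thesis .
qed

section \<open>Decomposition into flat disjuncts\<close>

text \<open>Each \<open>F \<in> R\<close> is the set of assignments satisfying one flat disjunct.\<close>

definition resolves :: "'p set \<Rightarrow> 'p fm \<Rightarrow> ('p \<rightharpoonup> bool) set set \<Rightarrow> bool" where
  "resolves D \<phi> R \<longleftrightarrow> finite R \<and> card R \<le> 2 ^ vrank \<phi> \<and>
     (\<forall>X. team_on D X \<longrightarrow> (sat X \<phi> \<longleftrightarrow> (\<exists>F\<in>R. X \<subseteq> F)))"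

lemma team_on_subset: "team_on D X \<Longrightarrow> Y \<subseteq> X \<Longrightarrow> team_on D Y"
  unfolding team_on_def by (meson subsetD)

lemma card_image_product_le:
  assumes "finite A" "finite B" "card A \<le> m" "card B \<le> n"
  shows "card ((\<lambda>(x, y). f x y) ` (A \<times> B)) \<le> m * n"
proof -
  have "card ((\<lambda>(x, y). f x y) ` (A \<times> B)) \<le> card (A \<times> B)"
    using assms by (intro card_image_le) auto
  also have "\<dots> \<le> m * n"
    using assms by (simp add: card_cartesian_product mult_le_mono)
  finally show ?thesis .
qed

text \<open>Lying in \<open>F \<inter> G\<close> means lying in both sets. The pairs number at most
  the product of the two bounds, which is what additivity of \<open>vrank\<close> allows.\<close>

lemma resolves_And:
  assumes "resolves D \<phi> R" "resolves D \<psi> S"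
  shows "resolves D (And \<phi> \<psi>) ((\<lambda>(F, G). F \<inter> G) ` (R \<times> S))"
proof -
  have "sat X (And \<phi> \<psi>) \<longleftrightarrow> (\<exists>F\<in>R. \<exists>G\<in>S. X \<subseteq> F \<inter> G)" if "team_on D X" for X
    using that assms unfolding resolves_def by auto
  then show ?thesis
    using assms card_image_product_le[of R S "2 ^ vrank \<phi>" "2 ^ vrank \<psi>" "(\<inter>)"]
    unfolding resolves_def by (auto simp: vrank_def power_add)
qed

lemma resolves_Or:
  assumes R: "resolves D \<phi> R" and S: "resolves D \<psi> S"
  shows "resolves D (Or \<phi> \<psi>) ((\<lambda>(F, G). F \<union> G) ` (R \<times> S))"
proof -
  have "sat X (Or \<phi> \<psi>) \<longleftrightarrow> (\<exists>F\<in>R. \<exists>G\<in>S. X \<subseteq> F \<union> G)" if X: "team_on D X" for X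
  proof
    assume "sat X (Or \<phi> \<psi>)"
    then obtain Y Z where YZ: "X = Y \<union> Z" "sat Y \<phi>" "sat Z \<psi>"
      by auto
    moreover from YZ X have "team_on D Y" "team_on D Z"
      by (auto simp: team_on_def)
    ultimately obtain F G where "F \<in> R" "G \<in> S" "Y \<subseteq> F" "Z \<subseteq> G"
      using R S unfolding resolves_def by metis
    with YZ show "\<exists>F\<in>R. \<exists>G\<in>S. X \<subseteq> F \<union> G"
      by blast
  next
    assume "\<exists>F\<in>R. \<exists>G\<in>S. X \<subseteq> F \<union> G"
    then obtain F G where FG: "F \<in> R" "G \<in> S" "X \<subseteq> F \<union> G"
      by blast
    \<comment> \<open>Cutting \<open>X\<close> along \<open>F\<close> and \<open>G\<close> gives the
      two parts for the semantics of \<open>Or\<close>; they may overlap.\<close>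
    have "sat (X \<inter> F) \<phi>" "sat (X \<inter> G) \<psi>"
      using R S FG team_on_subset[OF X] unfolding resolves_def by (meson inf_le1 inf_le2)+
    moreover have "X = (X \<inter> F) \<union> (X \<inter> G)"
      using FG by blast
    ultimately show "sat X (Or \<phi> \<psi>)"
      by auto
  qed
  then show ?thesis
    using assms card_image_product_le[of R S "2 ^ vrank \<phi>" "2 ^ vrank \<psi>" "(\<union>)"]
    unfolding resolves_def by (auto simp: vrank_def power_add)
qed

text \<open>The disjuncts are pooled, so the bounds add; the \<open>Suc\<close> in the rank of
  \<open>IOr\<close> doubles the bound and thereby absorbs the sum.\<close>

lemma resolves_IOr:
  assumes "resolves D \<phi> R" "resolves D \<psi> S"
  shows "resolves D (IOr \<phi> \<psi>) (R \<union> S)"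
proof -
  have "card (R \<union> S) \<le> card R + card S"
    by (rule card_Un_le)
  also have "\<dots> \<le> 2 ^ vrank \<phi> + 2 ^ vrank \<psi>"
    using assms by (simp add: resolves_def add_mono)
  also have "\<dots> \<le> 2 ^ (vrank \<phi> + vrank \<psi>) + 2 ^ (vrank \<phi> + vrank \<psi>)"
    by (intro add_mono power_increasing) auto
  also have "\<dots> = 2 ^ vrank (IOr \<phi> \<psi>)"
    by (simp add: vrank_def)
  finally show ?thesis
    using assms unfolding resolves_def by auto
qed

text \<open>A dependence atom holds iff \<open>q\<close> is given by some function \<open>g\<close> of the values of \<open>ps\<close>.\<close>

lemma resolves_Dep:
  fixes ps :: "'p list"
  assumes "props (Dep ps q) \<subseteq> D"
  defines "V \<equiv> {xs. set xs \<subseteq> {Some False, Some True} \<and> length xs = length ps}"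
  shows "resolves D (Dep ps q)
    ((\<lambda>g. {s. s q = g (map s ps)}) ` (V \<rightarrow>\<^sub>E {Some False, Some True}))"
proof -
  let ?B = "{Some False, Some True}"
  let ?F = "\<lambda>g. {s :: 'p \<rightharpoonup> bool. s q = g (map s ps)}"
  have V: "finite V" "card V = 2 ^ length ps"
    unfolding V_def by (auto simp: finite_lists_length_eq card_lists_length_eq numeral_2_eq_2)
  have fin: "finite (V \<rightarrow>\<^sub>E ?B)"
    using V by (intro finite_PiE) auto
  have "card (?F ` (V \<rightarrow>\<^sub>E ?B)) \<le> card (V \<rightarrow>\<^sub>E ?B)"
    by (rule card_image_le[OF fin])
  \<comment> \<open>There are \<open>2 ^ (2 ^ length ps)\<close> Boolean functions of
    \<open>length ps\<close> arguments, and the rank of the atom is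
    \<open>2 ^ length ps\<close>.\<close>
  also have "\<dots> = 2 ^ vrank (Dep ps q)"
    using V by (simp add: card_PiE vrank_def count_IOr_dep_replacement numeral_2_eq_2)
  finally have card: "card (?F ` (V \<rightarrow>\<^sub>E ?B)) \<le> 2 ^ vrank (Dep ps q)" .
  have "sat X (Dep ps q) \<longleftrightarrow> (\<exists>g\<in>V \<rightarrow>\<^sub>E ?B. X \<subseteq> ?F g)" if X: "team_on D X" for X
  proof
    assume sat: "sat X (Dep ps q)"
    have defined: "s p \<in> ?B" if "s \<in> X" "p \<in> props (Dep ps q)" for s p
    proof -
      from that assms X have "p \<in> dom s"
        by (auto simp: team_on_def)
      then show ?thesis
        by auto
    qed
    have V_mem: "map s ps \<in> V" if "s \<in> X" for s
      using defined[OF that] by (auto simp: V_def)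
    \<comment> \<open>A representative of the members of \<open>X\<close> with value vector
      \<open>xs\<close>; since the atom holds, its value at \<open>q\<close> does not depend on the
      choice.\<close>
    define w where "w xs = (SOME s. s \<in> X \<and> map s ps = xs)" for xs
    \<comment> \<open>The default \<open>Some True\<close> for vectors not realised in
      \<open>X\<close> only keeps the values in \<open>?B\<close>; restricting to \<open>V\<close>
      makes \<open>g\<close> extensional.\<close>
    define g where
      "g = (\<lambda>xs\<in>V. if \<exists>s\<in>X. map s ps = xs then w xs q else Some True)"
    have w: "w xs \<in> X \<and> map (w xs) ps = xs" if "\<exists>s\<in>X. map s ps = xs" for xs
      unfolding w_def using someI_ex[of "\<lambda>s. s \<in> X \<and> map s ps = xs"] that by blast
    have "g xs \<in> ?B" if "xs \<in> V" for xs
      using that w[of xs] defined[of "w xs" q] by (simp add: g_def)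
    moreover have "g xs = undefined" if "xs \<notin> V" for xs
      using that by (simp add: g_def)
    ultimately have "g \<in> V \<rightarrow>\<^sub>E ?B"
      by (intro PiE_I) auto
    moreover have "s q = g (map s ps)" if s: "s \<in> X" for s
    proof -
      have "w (map s ps) \<in> X \<and> map (w (map s ps)) ps = map s ps"
        using s w by blast
      then have "s q = w (map s ps) q"
        using sat s by (auto simp: map_eq_conv)
      then show ?thesis
        using V_mem[OF s] s by (auto simp: g_def)
    qed
    ultimately show "\<exists>g\<in>V \<rightarrow>\<^sub>E ?B. X \<subseteq> ?F g"
      by blast
  next
    assume "\<exists>g\<in>V \<rightarrow>\<^sub>E ?B. X \<subseteq> ?F g"
    then obtain g where g: "\<And>s. s \<in> X \<Longrightarrow> s q = g (map s ps)"
      by blast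
    show "sat X (Dep ps q)"
      unfolding sat.simps
    proof (intro ballI impI)
      fix s t assume "s \<in> X" "t \<in> X" "\<forall>p\<in>set ps. s p = t p"
      moreover from this have "map s ps = map t ps"
        by simp
      ultimately show "s q = t q"
        using g by metis
    qed
  qed
  with card fin show ?thesis
    unfolding resolves_def by auto
qed

lemma ex_resolves: "props \<phi> \<subseteq> D \<Longrightarrow> \<exists>R. resolves D \<phi> R"
proof (induction \<phi>)
  case (Pos p)
  have "resolves D (Pos p) {{s. s p = Some True}}"
    by (auto simp: resolves_def)
  then show ?case ..
next
  case (Neg p)
  have "resolves D (Neg p) {{s. s p = Some False}}"
    by (auto simp: resolves_def)
  then show ?case ..
next
  case (And \<phi> \<psi>)
  then obtain R S where "resolves D \<phi> R" "resolves D \<psi> S"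
    by auto
  then show ?case
    by (intro exI) (rule resolves_And)
next
  case (Or \<phi> \<psi>)
  then obtain R S where "resolves D \<phi> R" "resolves D \<psi> S"
    by auto
  then show ?case
    by (intro exI) (rule resolves_Or)
next
  case (IOr \<phi> \<psi>)
  then obtain R S where "resolves D \<phi> R" "resolves D \<psi> S"
    by auto
  then show ?case
    by (intro exI) (rule resolves_IOr)
next
  case (Dep ps q)
  then show ?case
    by (intro exI) (rule resolves_Dep)
qed

section \<open>Small falsifying subteams and their indexing\<close>

lemma small_falsifying_subteam:
  assumes "props \<phi> \<subseteq> D" "team_on D X" "\<not> sat X \<phi>"
  obtains Y where "Y \<subseteq> X" "finite Y" "card Y \<le> 2 ^ vrank \<phi>" "\<not> sat Y \<phi>"
proof -
  from assms obtain R where R: "resolves D \<phi> R"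
    using ex_resolves by blast
  with assms have "\<forall>F\<in>R. \<exists>s. s \<in> X \<and> s \<notin> F"
    by (auto simp: resolves_def)
  \<comment> \<open>\<open>c F\<close> prevents any team containing it from lying in
    \<open>F\<close>, so the image of \<open>R\<close> lies in no disjunct.\<close>
  then obtain c where c: "\<And>F. F \<in> R \<Longrightarrow> c F \<in> X \<and> c F \<notin> F"
    by metis
  show ?thesis
  proof
    show "c ` R \<subseteq> X"
      using c by blast
    then have "team_on D (c ` R)"
      using assms(2) team_on_subset by blast
    moreover have "\<not> (\<exists>F\<in>R. c ` R \<subseteq> F)"
      using c by blast
    ultimately show "\<not> sat (c ` R) \<phi>"
      using R unfolding resolves_def by blast
    show "finite (c ` R)"
      using R by (simp add: resolves_def)
    show "card (c ` R) \<le> 2 ^ vrank \<phi>"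
      using R card_image_le[of R c] unfolding resolves_def by (meson order_trans)
  qed
qed

text \<open>Repetitions fill up the root label when \<open>Y\<close> is smaller. Controlling
  \<open>range h\<close> as well gives every natural number an assignment from \<open>Y\<close>, so
  labels need not be tracked as subsets of the root label.\<close>

lemma finite_enumeration_onto:
  assumes "finite Y" "Y \<noteq> {}" "card Y \<le> n"
  obtains h :: "nat \<Rightarrow> 'a" where "h ` {1..n} = Y" "range h = Y"
proof -
  obtain e where "bij_betw e {1..card Y} Y"
    using finite_same_card_bij[of "{1..card Y}" Y] assms(1) by auto
  then have e: "e ` {1..card Y} = Y"
    by (simp add: bij_betw_def)
  obtain y where y: "y \<in> Y"
    using assms(2) by blast
  define h where "h i = (if i \<in> {1..card Y} then e i else y)" for i
  have "h ` {1..card Y} = e ` {1..card Y}"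
    by (rule image_cong) (auto simp: h_def)
  then have im: "h ` {1..card Y} = Y"
    using e by simp
  have range: "range h \<subseteq> Y"
    using e y by (auto simp: h_def)
  have "h ` {1..card Y} \<subseteq> h ` {1..n}"
    using assms(3) by (intro image_mono) auto
  with im range have "h ` {1..n} = Y" "range h = Y"
    by (auto simp: subset_iff)
  then show ?thesis
    by (rule that)
qed

section \<open>Truth of labeled formulas and soundness of the rules\<close>

definition falsified :: "'p set \<Rightarrow> (nat \<Rightarrow> 'p \<rightharpoonup> bool) \<Rightarrow> 'p lform \<Rightarrow> bool" where
  "falsified D h f \<longleftrightarrow> props (snd f) \<subseteq> D \<and> \<not> sat (h ` fst f) (snd f)"

lemma falsified_lit:
  "p \<in> D \<Longrightarrow> h i p = Some b \<Longrightarrow> falsified D h ({i}, lit p (\<not> b))"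
  by (cases b) (auto simp: falsified_def)

text \<open>An assignment never violates the atom together with itself, so the violating pair is
  \<open>h i\<close> and \<open>h j\<close> in one of the two orders, and the conclusion is
  symmetric.\<close>

lemma Dep_fails_on_pair:
  assumes "\<not> sat (h ` {i, j}) (Dep ps q)"
  shows "(\<forall>p\<in>set ps. h i p = h j p) \<and> h i q \<noteq> h j q"
proof -
  obtain s t where "s \<in> {h i, h j}" "t \<in> {h i, h j}" "\<forall>p\<in>set ps. s p = t p" "s q \<noteq> t q"
    using assms unfolding sat.simps by auto
  then show ?thesis
    by (metis insertE singletonD)
qed

lemma rule_inst_sound:
  assumes "rule_inst L f As" "falsified D h f" and dom: "\<And>i. dom (h i) = D"
  shows "\<exists>A\<in>As. \<forall>x\<in>A. falsified D h x"
  using assms(1,2)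
proof (cases rule: rule_inst.cases)
  case (Prop \<alpha> p)
  with assms(2) obtain i where "i \<in> \<alpha>" "falsified D h ({i}, Pos p)"
    by (auto simp: falsified_def)
  with Prop show ?thesis
    by blast
next
  case (NegProp \<alpha> p)
  with assms(2) obtain i where "i \<in> \<alpha>" "falsified D h ({i}, Neg p)"
    by (auto simp: falsified_def)
  with NegProp show ?thesis
    by blast
next
  case (And \<alpha> \<phi> \<psi>)
  with assms(2) show ?thesis
    by (auto simp: falsified_def)
next
  case (Or \<beta> \<alpha> \<phi> \<psi>)
  \<comment> \<open>If both parts satisfied their disjuncts, this union would witness the
    disjunction on \<open>\<alpha>\<close>. The images may overlap, as \<open>h\<close> need not be
    injective.\<close>
  have "h ` \<alpha> = h ` \<beta> \<union> h ` (\<alpha> - \<beta>)"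
    using Or by blast
  with assms(2) Or have "\<not> sat (h ` \<beta>) \<phi> \<or> \<not> sat (h ` (\<alpha> - \<beta>)) \<psi>"
    unfolding falsified_def by auto
  with assms(2) Or show ?thesis
    by (auto simp: falsified_def)
next
  case (IOr \<alpha> \<phi> \<psi>)
  with assms(2) show ?thesis
    by (auto simp: falsified_def)
next
  case (Split \<alpha> ps q)
  with assms(2) obtain i j where ij: "i \<in> \<alpha>" "j \<in> \<alpha>"
    "\<forall>p\<in>set ps. h i p = h j p" "h i q \<noteq> h j q"
    by (auto simp: falsified_def)
  \<comment> \<open>Different values at \<open>q\<close> force \<open>i \<noteq> j\<close>, so the
    pair is one of the alternatives of the rule.\<close>
  then have "card {i, j} = 2"
    by (metis card_2_iff)
  moreover have "falsified D h ({i, j}, Dep ps q)"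
    using assms(2) Split ij by (auto simp: falsified_def)
  ultimately show ?thesis
    using Split ij by blast
next
  case (PLdep i j ps q)
  have D: "set ps \<subseteq> D" "q \<in> D"
    using assms(2) PLdep by (auto simp: falsified_def)
  have agree: "\<forall>p\<in>set ps. h i p = h j p" and differ: "h i q \<noteq> h j q"
    using Dep_fails_on_pair[of h i j ps q] assms(2) PLdep(1)
    unfolding falsified_def by (metis fst_conv snd_conv)+
  \<comment> \<open>The negation is needed since labeled literals assert failure.\<close>
  define g where "g = map (\<lambda>p. \<not> the (h i p)) ps"
  have lits: "falsified D h ({k}, lit (ps ! m) (g ! m))"
    if "m < length ps" "k \<in> {i, j}" for k m
  proof -
    have p: "ps ! m \<in> set ps"
      using that by simp
    then have "ps ! m \<in> dom (h i)"
      using D dom by blast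
    then have "h i (ps ! m) = Some (the (h i (ps ! m)))"
      by auto
    moreover have "h k (ps ! m) = h i (ps ! m)"
      using that agree p by auto
    ultimately show ?thesis
      using that D p by (simp add: g_def falsified_lit subsetD)
  qed
  have "falsified D h ({i, j}, Pos q)" "falsified D h ({i, j}, Neg q)"
    using D differ by (auto simp: falsified_def)
  with lits have "\<forall>x\<in>(\<Union>m<length ps. {({i}, lit (ps ! m) (g ! m)), ({j}, lit (ps ! m) (g ! m))})
      \<union> {({i, j}, Pos q), ({i, j}, Neg q)}. falsified D h x"
    by auto
  moreover have "length g = length ps"
    by (simp add: g_def)
  ultimately show ?thesis
    unfolding PLdep(2) by blast
qed

text \<open>The fully falsified branch is followed downwards, at each node into the alternative
  given by \<open>rule_inst_sound\<close>. Existence of that alternative also excludes rule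
  instances without alternatives.\<close>

lemma grown_falsified_branch:
  assumes "grown L B T" "\<forall>x\<in>B \<union> block T. falsified D h x" and dom: "\<And>i. dom (h i) = D"
  shows "\<exists>C\<in>branches T. \<forall>x\<in>C. falsified D h x"
  using assms(1,2)
proof (induction rule: grown.induct)
  case (leaf B A)
  then show ?case
    by simp
next
  case (extend f B A As ts)
  then obtain C where C: "C \<in> As" "\<forall>x\<in>C. falsified D h x"
    using rule_inst_sound[where h = h, OF extend.hyps(2) _ dom] by force
  \<comment> \<open>The child may omit formulas of \<open>C\<close> already present; what remains is
    still falsified.\<close>
  then have "C - (B \<union> A) \<in> block ` set ts"
    using extend.hyps(3) by blast
  then obtain t where t: "t \<in> set ts" "block t = C - (B \<union> A)"
    by auto
  then have "\<forall>x\<in>(B \<union> A) \<union> block t. falsified D h x"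
    using C extend.prems by auto
  then obtain E where "E \<in> branches t" "\<forall>x\<in>E. falsified D h x"
    using extend.IH t by blast
  moreover have "A \<union> E \<in> branches (Node A ts)"
    using t calculation by auto
  ultimately show ?case
    using extend.prems by (intro bexI[of _ "A \<union> E"]) auto
qed

text \<open>On a singleton team a proposition in the domain has one definite value, and dependence
  atoms hold trivially; the empty team satisfies everything.\<close>

lemma closed_branch_not_falsified:
  assumes "closed_branch B" and dom: "\<And>i. dom (h i) = D"
  shows "\<exists>x\<in>B. \<not> falsified D h x"
proof -
  consider i p where "({i}, Pos p) \<in> B" "({i}, Neg p) \<in> B"
    | \<psi> where "({}, \<psi>) \<in> B"
    | i ps q where "({i}, Dep ps q) \<in> B"
    using assms(1) unfolding closed_branch_def by blast
  then show ?thesis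
  proof cases
    case (1 i p)
    have "\<not> falsified D h ({i}, Pos p) \<or> \<not> falsified D h ({i}, Neg p)"
      using dom[of i] by (auto simp: falsified_def)
    with 1 show ?thesis
      by blast
  next
    case 2
    then show ?thesis
      by (intro bexI) (auto simp: falsified_def sat_empty_team)
  next
    case 3
    then show ?thesis
      by (intro bexI) (auto simp: falsified_def)
  qed
qed

theorem theorem6:
  fixes L :: language and \<phi> :: "'p fm"
  assumes "formula_of L \<phi>"
    and "\<exists>T. tableau_for L \<phi> T \<and> closed_tableau T"
  shows "valid \<phi>"
proof (rule ccontr)
  assume "\<not> valid \<phi>"
  then obtain D X where X: "props \<phi> \<subseteq> D" "team_on D X" "\<not> sat X \<phi>"
    unfolding valid_def by blast
  then obtain Y where Y: "Y \<subseteq> X" "finite Y" "card Y \<le> 2 ^ vrank \<phi>" "\<not> sat Y \<phi>"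
    by (rule small_falsifying_subteam)
  \<comment> \<open>Nonemptiness is what allows a total indexing function with range
    \<open>Y\<close>.\<close>
  then have "Y \<noteq> {}"
    using sat_empty_team by blast
  obtain h :: "nat \<Rightarrow> 'p \<rightharpoonup> bool"
    where h: "h ` {1..2 ^ vrank \<phi>} = Y" "range h = Y"
    by (rule finite_enumeration_onto[OF Y(2) \<open>Y \<noteq> {}\<close> Y(3)])
  have dom: "dom (h i) = D" for i
  proof -
    have "h i \<in> range h"
      by simp
    then have "h i \<in> X"
      unfolding h(2) using Y(1) by (rule set_rev_mp)
    then show ?thesis
      using X(2) by (simp add: team_on_def)
  qed
  obtain T where T: "block T = {({1..2 ^ vrank \<phi>}, \<phi>)}" "grown L {} T" "closed_tableau T"
    using assms(2) unfolding tableau_for_def by blast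
  have "\<forall>x\<in>{} \<union> block T. falsified D h x"
    using T h X Y by (simp add: falsified_def)
  then obtain C where "C \<in> branches T" "\<forall>x\<in>C. falsified D h x"
    using grown_falsified_branch[where h = h, OF T(2) _ dom] by blast
  then show False
    using T(3) closed_branch_not_falsified[where h = h, OF _ dom] unfolding closed_tableau_def by blast
qed

end
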